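(* Consider the status-updating semi-Markov decision process described in the context with a reliable channel, $p_s=1$. Suppose $\frac12 L(\boldsymbol a_f)(L(\boldsymbol a_f)+1)\ge\omega C(\boldsymbol a_f)$. Then on $\mathcal S^\dagger$ there is an optimal policy $\pi^*$ of switch type: there exists a threshold $\Omega\ge\min\{T_u,T_p+T_u'\}$ such that, when $T_u\le T_p+T_u'$, $$\pi^*(s)=\begin{cases}(1,1), & T_u\le s<\Omega,\\ (0,1), & s\ge\Omega,\end{cases}$$ and when $T_u\ge T_p+T_u'$, $$\pi^*(s)=\begin{cases}(0,1), & T_p+T_u'\le s<\Omega,\\ (1,1), & s\ge\Omega,\end{cases}$$ for $s\in\mathcal S^\dagger$.
   Context: Parameters: positive integers $T_u$ and $T_u'$ (sizes in packets of a status update before and after preprocessing; one packet is sent per minislot), positive reals $l$ (bits per packet), $v$ (CPU cycles per bit), $f$ (CPU frequency), $\tau$ (minislot length), $\kappa$, $P$, and a weighting factor $\omega>0$. Put $T_p=\lceil T_u l v/(f\tau)\rceil$, $C_p=\kappa\tau f^3$, $C_u=P\tau$. The packet success probability is $p_s=1$. Actions: $\mathcal A=\{(0,0),(0,1),(1,1)\}$ (idle; transmit directly; preprocess then transmit). Durations in minislots: $L((0,0))=1$, $L((0,1))=T_u$, $L((1,1))=T_p+T_u'$. Energies: $C((0,0))=0$, $C((0,1))=T_uC_u$, $C((1,1))=T_pC_p+T_u'C_u$. States: the age of information (AoI) $s\in\mathcal S=\{1,2,\dots,\hat\delta\}$, where the upper limit $\hat\delta$ is assumed finite but arbitrarily large.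 $\mathcal S^\dagger=\{\min\{T_u,T_p+T_u'\},\dots,\hat\delta\}$ (smaller states are non-recurrent). Transitions $p(\cdot\mid s,\boldsymbol a)$ (deterministic since $p_s=1$): under $(0,0)$ the next state is $\min(s+1,\hat\delta)$; under $\boldsymbol a\in\{(0,1),(1,1)\}$ it is $\min(L(\boldsymbol a),\hat\delta)$. Cost of a time step: $R(s,\boldsymbol a)=\frac12(2s+L(\boldsymbol a)-1)L(\boldsymbol a)+\omega C(\boldsymbol a)$. The objective is to minimize, over stationary deterministic policies (attention is restricted to unichain policies), the average cost $\limsup_{T\to\infty}\mathbb E[\sum_{t=1}^T R(s(t),\boldsymbol a(t))]/\mathbb E[\sum_{t=1}^T L(\boldsymbol a(t))]$. Equivalent discrete-time MDP: fix $\epsilon\in(0,\min_{\boldsymbol a}L(\boldsymbol a)]$, and set $\bar R(s,\boldsymbol a)=R(s,\boldsymbol a)/L(\boldsymbol a)$, $\bar p(s'\mid s,\boldsymbol a)=\frac{\epsilon}{L(\boldsymbol a)}p(s'\mid s,\boldsymbol a)$ for $s'\ne s$, and $\bar p(s\mid s,\boldsymbol a)=1-\frac{\epsilon}{L(\boldsymbol a)}+\frac{\epsilon}{L(\boldsymbol a)}p(s\mid s,\boldsymbol a)$. The optimal average cost $\theta$ and the value function $V$ satisfy $\theta+V(s)=\min_{\boldsymbol a\in\mathcal A}\{\bar R(s,\boldsymbol a)+\sum_{s'\in\mathcal S}\bar p(s'\mid s,\boldsymbol a)V(s')\}$ for all $s\in\mathcal S$, and an optimal policy $\pi^*$ is one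 for which $\pi^*(s)$ attains this minimum. The action $\boldsymbol a_f$ is $(0,1)$ if $T_u\le T_p+T_u'$ and $(1,1)$ if $T_u\ge T_p+T_u'$ (either one in case of equality). *)

theory Defs
  imports "HOL-Probability.Probability"
begin

record status_update =
  upd_size :: nat           (* T_u *)
  pre_size :: nat           (* T_u' *)
  bits_per_packet :: real   (* l *)
  cycles_per_bit :: real    (* v *)
  cpu_freq :: real          (* f *)
  minislot :: real          (* tau *)
  kappa :: real
  tx_power :: real          (* P *)
  weight :: real            (* omega *)

definition valid_params :: "status_update \<Rightarrow> bool" where
  "valid_params M \<longleftrightarrow> upd_size M > 0 \<and> pre_size M > 0 \<and> bits_per_packet M > 0 \<and>
     cycles_per_bit M > 0 \<and> cpu_freq M > 0 \<and> minislot M > 0 \<and> kappa M > 0 \<and>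
     tx_power M > 0 \<and> weight M > 0"

definition pre_time :: "status_update \<Rightarrow> nat" where
  "pre_time M = nat \<lceil>real (upd_size M) * bits_per_packet M * cycles_per_bit M
                      / (cpu_freq M * minislot M)\<rceil>"

definition pre_energy :: "status_update \<Rightarrow> real" where
  "pre_energy M = kappa M * minislot M * cpu_freq M ^ 3"

definition tx_energy :: "status_update \<Rightarrow> real" where
  "tx_energy M = tx_power M * minislot M"

(* The actions (0,0), (0,1) and (1,1): idle; transmit directly; preprocess, then transmit. *)
datatype action = Idle | Direct | Preprocess

lemma UNIV_action: "UNIV = {Idle, Direct, Preprocess}"
  using action.exhaust by blast

instance action :: finite
  by standard (simp add: UNIV_action)

fun duration :: "status_update \<Rightarrow> action \<Rightarrow> nat" where
  "duration M Idle = 1"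
| "duration M Direct = upd_size M"
| "duration M Preprocess = pre_time M + pre_size M"

fun energy :: "status_update \<Rightarrow> action \<Rightarrow> real" where
  "energy M Idle = 0"
| "energy M Direct = real (upd_size M) * tx_energy M"
| "energy M Preprocess = real (pre_time M) * pre_energy M + real (pre_size M) * tx_energy M"

definition step_cost :: "status_update \<Rightarrow> nat \<Rightarrow> action \<Rightarrow> real" where
  "step_cost M s a =
     (2 * real s + real (duration M a) - 1) * real (duration M a) / 2 + weight M * energy M a"

(* Throughout, D is the upper limit of the age of information. *)

definition states :: "nat \<Rightarrow> nat set" where
  "states D = {1..D}"

definition main_states :: "status_update \<Rightarrow> nat \<Rightarrow> nat set" where
  "main_states M D = {min (upd_size M) (pre_time M + pre_size M)..D}"

(* The packet success probability is 1, so every transition is deterministic. *)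
definition kernel :: "status_update \<Rightarrow> nat \<Rightarrow> nat \<Rightarrow> action \<Rightarrow> nat pmf" where
  "kernel M D s a =
     (if a = Idle then return_pmf (min (s + 1) D) else return_pmf (min (duration M a) D))"

(* A stationary deterministic policy is a function nat => action; only its values on
   states D matter. *)

(* Law of the first T states s(1), ..., s(T), started in s(1) = s. *)
primrec run :: "status_update \<Rightarrow> nat \<Rightarrow> (nat \<Rightarrow> action) \<Rightarrow> nat \<Rightarrow> nat \<Rightarrow> nat list pmf" where
  "run M D \<pi> 0 s = return_pmf []"
| "run M D \<pi> (Suc T) s =
     bind_pmf (kernel M D s (\<pi> s)) (\<lambda>s'. map_pmf ((#) s) (run M D \<pi> T s'))"

definition avg_cost :: "status_update \<Rightarrow> nat \<Rightarrow> (nat \<Rightarrow> action) \<Rightarrow> nat \<Rightarrow> ereal" where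
  "avg_cost M D \<pi> s = limsup (\<lambda>T. ereal
     (measure_pmf.expectation (run M D \<pi> T s) (\<lambda>xs. \<Sum>x\<leftarrow>xs. step_cost M x (\<pi> x)) /
      measure_pmf.expectation (run M D \<pi> T s) (\<lambda>xs. \<Sum>x\<leftarrow>xs. real (duration M (\<pi> x)))))"

definition reach :: "status_update \<Rightarrow> nat \<Rightarrow> (nat \<Rightarrow> action) \<Rightarrow> (nat \<times> nat) set" where
  "reach M D \<pi> = {(s, s'). s \<in> states D \<and> s' \<in> states D \<and> pmf (kernel M D s (\<pi> s)) s' > 0}\<^sup>*"

(* In a finite chain a state is recurrent iff it can be reached back from every state
   reachable from it. *)
definition recurrent :: "status_update \<Rightarrow> nat \<Rightarrow> (nat \<Rightarrow> action) \<Rightarrow> nat \<Rightarrow> bool" where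
  "recurrent M D \<pi> s \<longleftrightarrow>
     s \<in> states D \<and> (\<forall>s'. (s, s') \<in> reach M D \<pi> \<longrightarrow> (s', s) \<in> reach M D \<pi>)"

definition unichain :: "status_update \<Rightarrow> nat \<Rightarrow> (nat \<Rightarrow> action) \<Rightarrow> bool" where
  "unichain M D \<pi> \<longleftrightarrow>
     (\<forall>s s'. recurrent M D \<pi> s \<and> recurrent M D \<pi> s' \<longrightarrow> (s, s') \<in> reach M D \<pi>)"

(* The average cost of a unichain policy does not depend on the initial state; hence a single
   number is required to be optimal from all of them. *)
definition optimal_avg_cost :: "status_update \<Rightarrow> nat \<Rightarrow> real \<Rightarrow> bool" where
  "optimal_avg_cost M D \<theta> \<longleftrightarrow>
     (\<forall>s\<in>states D. ereal \<theta> = (INF \<pi>\<in>{\<pi>. unichain M D \<pi>}. avg_cost M D \<pi> s))"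

(* Uniformisation of the semi-Markov process: costs are taken per minislot and a self-loop of
   probability 1 - eps / duration compensates for the different durations of the actions. *)

definition rate_cost :: "status_update \<Rightarrow> nat \<Rightarrow> action \<Rightarrow> real" where
  "rate_cost M s a = step_cost M s a / real (duration M a)"

definition dt_trans ::
    "status_update \<Rightarrow> nat \<Rightarrow> real \<Rightarrow> nat \<Rightarrow> action \<Rightarrow> nat \<Rightarrow> real" where
  "dt_trans M D eps s a s' =
     (if s' \<noteq> s then eps / real (duration M a) * pmf (kernel M D s a) s'
      else 1 - eps / real (duration M a) + eps / real (duration M a) * pmf (kernel M D s a) s)"

definition q_value ::
    "status_update \<Rightarrow> nat \<Rightarrow> real \<Rightarrow> (nat \<Rightarrow> real) \<Rightarrow> nat \<Rightarrow> action \<Rightarrow> real" where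
  "q_value M D eps V s a =
     rate_cost M s a + (\<Sum>s'\<in>states D. dt_trans M D eps s a s' * V s')"

definition bellman ::
    "status_update \<Rightarrow> nat \<Rightarrow> real \<Rightarrow> real \<Rightarrow> (nat \<Rightarrow> real) \<Rightarrow> bool" where
  "bellman M D eps \<theta> V \<longleftrightarrow>
     (\<forall>s\<in>states D. \<theta> + V s = Min (range (q_value M D eps V s)))"

definition optimal_policy ::
    "status_update \<Rightarrow> nat \<Rightarrow> real \<Rightarrow> (nat \<Rightarrow> action) \<Rightarrow> bool" where
  "optimal_policy M D eps \<pi> \<longleftrightarrow>
     unichain M D \<pi> \<and>
     (\<exists>\<theta> V. optimal_avg_cost M D \<theta> \<and> (\<forall>s\<in>states D. avg_cost M D \<pi> s = ereal \<theta>) \<and>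
        bellman M D eps \<theta> V \<and>
        (\<forall>s\<in>states D. q_value M D eps V s (\<pi> s) = Min (range (q_value M D eps V s))))"

(* An action of least duration among the two transmitting ones; in case of a tie, either. *)
definition fastest :: "status_update \<Rightarrow> action \<Rightarrow> bool" where
  "fastest M a \<longleftrightarrow>
     (a = Direct \<and> upd_size M \<le> pre_time M + pre_size M) \<or>
     (a = Preprocess \<and> upd_size M \<ge> pre_time M + pre_size M)"

end

theory Submission
  imports Defs
begin

text \<open>
  Multiplying by the durations and rescaling \<open>V\<close> by \<open>eps\<close> turns the uniformised Bellman
  equation into \<open>h s = min\<^sub>a (R s a - \<theta> L a + h s')\<close>. Without idling, a transmission leads to
  one of the two ages \<open>m \<le> n\<close> (the two durations), so \<open>\<theta>\<close> is the least average cost of three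
  cycles: always fast, always slow, alternating. On \<open>s \<ge> m\<close> the solution \<open>h\<close> is then the minimum
  of two affine functions of slopes \<open>m\<close> and \<open>n\<close>, whence the switch structure; idling
  at \<open>s \<ge> m\<close> does not pay since \<open>h (s + 1) \<ge> h s + m\<close> and the energy hypothesis gives
  \<open>\<theta> \<le> 2 m \<le> s + m\<close>. Below \<open>m\<close> the solution is continued by backward recursion.
\<close>

section \<open>Deterministic dynamics\<close>

definition next_state :: "status_update \<Rightarrow> nat \<Rightarrow> nat \<Rightarrow> action \<Rightarrow> nat" where
  "next_state M D s a = (if a = Idle then min (s + 1) D else min (duration M a) D)"

lemma kernel_eq_return: "kernel M D s a = return_pmf (next_state M D s a)"
  by (simp add: kernel_def next_state_def)

lemma duration_pos: "valid_params M \<Longrightarrow> duration M a > 0"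
  by (cases a) (auto simp: valid_params_def)

lemma next_state_in_states:
  assumes "valid_params M" "s \<in> states D"
  shows "next_state M D s a \<in> states D"
  using duration_pos[OF assms(1), of a] assms(2) by (auto simp: next_state_def states_def)

primrec orbit :: "('a \<Rightarrow> 'a) \<Rightarrow> nat \<Rightarrow> 'a \<Rightarrow> 'a list" where
  "orbit f 0 s = []"
| "orbit f (Suc T) s = s # orbit f T (f s)"

lemma run_eq_orbit: "run M D \<pi> T s = return_pmf (orbit (\<lambda>s. next_state M D s (\<pi> s)) T s)"
  by (induction T arbitrary: s) (simp_all add: kernel_eq_return bind_return_pmf)

lemma avg_cost_eq:
  "avg_cost M D \<pi> s = limsup (\<lambda>T. ereal
     ((\<Sum>x\<leftarrow>orbit (\<lambda>s. next_state M D s (\<pi> s)) T s. step_cost M x (\<pi> x)) /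
      (\<Sum>x\<leftarrow>orbit (\<lambda>s. next_state M D s (\<pi> s)) T s. real (duration M (\<pi> x)))))"
  by (simp add: avg_cost_def run_eq_orbit)

section \<open>Average cost bounds from a relative value function\<close>

lemma orbit_sum_ge_length:
  assumes "\<And>x. c x \<ge> (1::real)"
  shows "(\<Sum>x\<leftarrow>orbit f T s. c x) \<ge> real T"
proof (induction T arbitrary: s)
  case (Suc T)
  show ?case using Suc[of "f s"] assms[of s] by simp
qed simp

text \<open>Summing the inequality for \<open>h\<close> along the orbit telescopes: only
  \<open>h s\<close> and the value at the end point remain, and the latter is at most
  \<open>K\<close>.\<close>

lemma orbit_sum_lower:
  fixes c d h :: "'a \<Rightarrow> real"
  assumes "\<And>x. x \<in> S \<Longrightarrow> f x \<in> S" "\<And>x. x \<in> S \<Longrightarrow> h x \<le> K"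
    and "\<And>x. x \<in> S \<Longrightarrow> h x \<le> c x - \<theta> * d x + h (f x)"
    and "s \<in> S"
  shows "h s - K \<le> (\<Sum>x\<leftarrow>orbit f T s. c x) - \<theta> * (\<Sum>x\<leftarrow>orbit f T s. d x)"
  using assms(4)
proof (induction T arbitrary: s)
  case 0
  then show ?case using assms(2) by simp
next
  case (Suc T)
  show ?case
    using Suc.IH[of "f s"] assms(1,3)[OF Suc.prems] by (simp add: algebra_simps)
qed

lemma orbit_sum_upper:
  fixes c d h :: "'a \<Rightarrow> real"
  assumes "\<And>x. x \<in> S \<Longrightarrow> f x \<in> S" "\<And>x. x \<in> S \<Longrightarrow> K \<le> h x"
    and "\<And>x. x \<in> S \<Longrightarrow> c x - \<theta> * d x + h (f x) \<le> h x"
    and "s \<in> S"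
  shows "(\<Sum>x\<leftarrow>orbit f T s. c x) - \<theta> * (\<Sum>x\<leftarrow>orbit f T s. d x) \<le> h s - K"
  using assms(4)
proof (induction T arbitrary: s)
  case 0
  then show ?case using assms(2) by simp
next
  case (Suc T)
  show ?case
    using Suc.IH[of "f s"] assms(1,3)[OF Suc.prems] by (simp add: algebra_simps)
qed

lemma tendsto_ereal_minus_inverse: "(\<lambda>T. ereal (\<theta> + C / real T)) \<longlonglongrightarrow> ereal \<theta>"
  using tendsto_add[OF tendsto_const lim_const_over_n[of C], of \<theta>] by simp

text \<open>Every duration is at least 1, so the elapsed time is at least \<open>T\<close> and the
  bounded error left by telescoping vanishes in the ratio.\<close>

lemma avg_cost_lower:
  assumes "valid_params M" "s \<in> states D"
    and "\<And>x. x \<in> states D \<Longrightarrow>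
      h x \<le> step_cost M x (\<pi> x) - \<theta> * real (duration M (\<pi> x)) + h (next_state M D x (\<pi> x))"
  shows "ereal \<theta> \<le> avg_cost M D \<pi> s"
proof -
  let ?f = "\<lambda>s. next_state M D s (\<pi> s)"
  let ?S = "\<lambda>T. \<Sum>x\<leftarrow>orbit ?f T s. step_cost M x (\<pi> x)"
  let ?L = "\<lambda>T. \<Sum>x\<leftarrow>orbit ?f T s. real (duration M (\<pi> x))"
  define K where "K = Max (h ` states D)"
  have K: "h x \<le> K" if "x \<in> states D" for x
    using that by (simp add: K_def states_def)
  have L: "real T \<le> ?L T" for T
    using duration_pos[OF assms(1)] by (intro orbit_sum_ge_length) (simp add: Suc_leI)
  have S: "h s - K \<le> ?S T - \<theta> * ?L T" for T
    using K assms by (intro orbit_sum_lower[where S = "states D"] next_state_in_states)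
  have "\<theta> + (h s - K) / real T \<le> ?S T / ?L T" if "T > 0" for T
  proof -
    \<comment> \<open>The numerator is nonpositive because \<open>K\<close> is the maximum of
      \<open>h\<close>, so a larger denominator can only raise the quotient.\<close>
    have "(h s - K) / real T \<le> (h s - K) / ?L T"
      using K[OF assms(2)] L[of T] that by (intro divide_left_mono_neg) auto
    also have "\<dots> \<le> (?S T - \<theta> * ?L T) / ?L T"
      using S[of T] L[of T] by (intro divide_right_mono) auto
    also have "\<dots> = ?S T / ?L T - \<theta>"
      using L[of T] that by (simp add: field_simps)
    finally show ?thesis by simp
  qed
  then have "limsup (\<lambda>T. ereal (\<theta> + (h s - K) / real T)) \<le> limsup (\<lambda>T. ereal (?S T / ?L T))"
    by (intro Limsup_mono eventually_mono[OF eventually_gt_at_top[of 0]]) simp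
  moreover have "limsup (\<lambda>T. ereal (\<theta> + (h s - K) / real T)) = ereal \<theta>"
    by (intro lim_imp_Limsup tendsto_ereal_minus_inverse) simp
  ultimately show ?thesis by (simp add: avg_cost_eq)
qed

lemma avg_cost_upper:
  assumes "valid_params M" "s \<in> states D"
    and "\<And>x. x \<in> states D \<Longrightarrow>
      step_cost M x (\<pi> x) - \<theta> * real (duration M (\<pi> x)) + h (next_state M D x (\<pi> x)) \<le> h x"
  shows "avg_cost M D \<pi> s \<le> ereal \<theta>"
proof -
  let ?f = "\<lambda>s. next_state M D s (\<pi> s)"
  let ?S = "\<lambda>T. \<Sum>x\<leftarrow>orbit ?f T s. step_cost M x (\<pi> x)"
  let ?L = "\<lambda>T. \<Sum>x\<leftarrow>orbit ?f T s. real (duration M (\<pi> x))"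
  define K where "K = Min (h ` states D)"
  have K: "K \<le> h x" if "x \<in> states D" for x
    using that by (simp add: K_def states_def)
  have L: "real T \<le> ?L T" for T
    using duration_pos[OF assms(1)] by (intro orbit_sum_ge_length) (simp add: Suc_leI)
  have S: "?S T - \<theta> * ?L T \<le> h s - K" for T
    using K assms by (intro orbit_sum_upper[where S = "states D"] next_state_in_states)
  have "?S T / ?L T \<le> \<theta> + (h s - K) / real T" if "T > 0" for T
  proof -
    have "?S T / ?L T - \<theta> = (?S T - \<theta> * ?L T) / ?L T"
      using L[of T] that by (simp add: field_simps)
    also have "\<dots> \<le> (h s - K) / ?L T"
      using S[of T] L[of T] by (intro divide_right_mono) auto
    also have "\<dots> \<le> (h s - K) / real T"
      using K[OF assms(2)] L[of T] that by (intro divide_left_mono) auto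
    finally show ?thesis by simp
  qed
  then have "limsup (\<lambda>T. ereal (?S T / ?L T)) \<le> limsup (\<lambda>T. ereal (\<theta> + (h s - K) / real T))"
    by (intro Limsup_mono eventually_mono[OF eventually_gt_at_top[of 0]]) simp
  moreover have "limsup (\<lambda>T. ereal (\<theta> + (h s - K) / real T)) = ereal \<theta>"
    by (intro lim_imp_Limsup tendsto_ereal_minus_inverse) simp
  ultimately show ?thesis by (simp add: avg_cost_eq)
qed

section \<open>Uniformisation and verification\<close>

lemma q_value_eq:
  assumes "valid_params M" "s \<in> states D"
  shows "q_value M D eps V s a =
    V s + (step_cost M s a + eps * V (next_state M D s a) - eps * V s) / real (duration M a)"
proof -
  let ?t = "next_state M D s a" and ?e = "eps / real (duration M a)"
  \<comment> \<open>Separate indicators for the self-loop and the jump also cover a successor equal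
    to \<open>s\<close>, as when idling at \<open>D\<close>.\<close>
  have "dt_trans M D eps s a s' * V s' =
      (if s' = s then (1 - ?e) * V s else 0) + (if s' = ?t then ?e * V ?t else 0)" for s'
    by (auto simp: dt_trans_def kernel_eq_return algebra_simps)
  then have "(\<Sum>s'\<in>states D. dt_trans M D eps s a s' * V s') = (1 - ?e) * V s + ?e * V ?t"
    using assms next_state_in_states[OF assms, of a] by (simp add: sum.distrib states_def)
  then show ?thesis
    using duration_pos[OF assms(1), of a] by (simp add: q_value_def rate_cost_def field_simps)
qed

text \<open>With \<open>V = h / eps\<close>, the difference
  \<open>q_value M D eps V s a - V s - \<theta>\<close> is the slack in \<open>lower\<close> divided
  by the duration, so signs and equalities carry over. Since \<open>lower\<close> concerns all
  actions, it bounds the cost of every policy; \<open>\<pi>\<close> attains this bound and, being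
  unichain, competes in the infimum.\<close>

lemma optimal_policy_verification:
  assumes M: "valid_params M" and eps: "eps > 0" and uni: "unichain M D \<pi>"
    and lower: "\<And>s a. s \<in> states D \<Longrightarrow>
      h s \<le> step_cost M s a - \<theta> * real (duration M a) + h (next_state M D s a)"
    and attained: "\<And>s. s \<in> states D \<Longrightarrow>
      h s = step_cost M s (\<pi> s) - \<theta> * real (duration M (\<pi> s)) + h (next_state M D s (\<pi> s))"
  shows "optimal_policy M D eps \<pi>"
proof -
  define V where "V s = h s / eps" for s
  have V: "eps * V s = h s" for s using eps by (simp add: V_def)
  have avg: "avg_cost M D \<pi> s = ereal \<theta>" if "s \<in> states D" for s
    using that attained
    by (intro antisym avg_cost_lower[OF M _ lower] avg_cost_upper[OF M, where h = h]) auto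
  have opt: "optimal_avg_cost M D \<theta>"
    unfolding optimal_avg_cost_def
  proof
    fix s assume s: "s \<in> states D"
    show "ereal \<theta> = (INF \<pi>\<in>{\<pi>. unichain M D \<pi>}. avg_cost M D \<pi> s)"
      using uni avg[OF s]
      by (intro antisym INF_greatest avg_cost_lower[OF M s lower] INF_lower2[of \<pi>]) auto
  qed
  have ge: "\<theta> + V s \<le> q_value M D eps V s a" if "s \<in> states D" for s a
    using lower[OF that, of a] duration_pos[OF M, of a]
    by (simp add: q_value_eq[OF M that] V field_simps)
  have eq: "q_value M D eps V s (\<pi> s) = \<theta> + V s" if "s \<in> states D" for s
    using attained[OF that] duration_pos[OF M, of "\<pi> s"]
    by (simp add: q_value_eq[OF M that] V field_simps)
  have "Min (range (q_value M D eps V s)) = \<theta> + V s" if "s \<in> states D" for s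
    using ge[OF that] by (intro Min_eqI) (auto simp flip: eq[OF that])
  then show ?thesis
    unfolding optimal_policy_def bellman_def using uni opt avg eq
    by (intro conjI exI[of _ \<theta>] exI[of _ V]) auto
qed

section \<open>Reachability and the unichain property\<close>

lemma reach_step:
  assumes "valid_params M" "s \<in> states D" "(next_state M D s (\<pi> s), z) \<in> reach M D \<pi>"
  shows "(s, z) \<in> reach M D \<pi>"
  using _ assms(3) unfolding reach_def
proof (rule converse_rtrancl_into_rtrancl)
  show "(s, next_state M D s (\<pi> s)) \<in>
      {(s, s'). s \<in> states D \<and> s' \<in> states D \<and> pmf (kernel M D s (\<pi> s)) s' > 0}"
    using next_state_in_states[OF assms(1,2)] assms(2) by (simp add: kernel_eq_return)
qed

text \<open>A recurrent state can be reached back from \<open>z\<close>, so \<open>z\<close> links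
  any two of them.\<close>

lemma unichain_if_common_reachable:
  assumes "\<And>s. s \<in> states D \<Longrightarrow> (s, z) \<in> reach M D \<pi>"
  shows "unichain M D \<pi>"
  unfolding unichain_def
proof (intro allI impI)
  fix s s' assume "recurrent M D \<pi> s \<and> recurrent M D \<pi> s'"
  then have "(s, z) \<in> reach M D \<pi>" "(z, s') \<in> reach M D \<pi>"
    using assms by (auto simp: recurrent_def)
  then show "(s, s') \<in> reach M D \<pi>"
    unfolding reach_def by (rule rtrancl_trans)
qed

section \<open>Solution of the optimality equation and the switch policy\<close>

text \<open>The three cases are the cycles \<open>p\<close>, \<open>q\<close> and \<open>p, q\<close>; in each, \<open>\<theta>\<close> is the least of
  the three average costs.\<close>

lemma two_state_bellman:
  fixes p q \<alpha> \<beta> :: real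
  assumes "p > 0" "q > 0"
  shows "\<exists>\<theta> x y. \<theta> * p \<le> p * p + \<alpha> \<and> \<theta> * q \<le> q * q + \<beta> \<and>
    x = min (p * p + \<alpha> - \<theta> * p + x) (q * p + \<beta> - \<theta> * q + y) \<and>
    y = min (p * q + \<alpha> - \<theta> * p + x) (q * q + \<beta> - \<theta> * q + y)"
proof -
  define t1 where "t1 = (p * p + \<alpha>) / p"
  define t2 where "t2 = (q * q + \<beta>) / q"
  define t3 where "t3 = (p * q + \<alpha> + q * p + \<beta>) / (p + q)"
  have t: "t1 * p = p * p + \<alpha>" "t2 * q = q * q + \<beta>" "t3 * (p + q) = p * q + \<alpha> + q * p + \<beta>"
    using assms by (simp_all add: t1_def t2_def t3_def)
  define \<theta> where "\<theta> = min t1 (min t2 t3)"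
  have le: "\<theta> * p \<le> t1 * p" "\<theta> * q \<le> t2 * q" "\<theta> * (p + q) \<le> t3 * (p + q)"
    using assms by (auto simp: \<theta>_def intro!: mult_right_mono)
  have "\<theta> = t1 \<or> \<theta> = t2 \<or> \<theta> = t3" by (auto simp: \<theta>_def min_def)
  then show ?thesis
  proof (elim disjE)
    \<comment> \<open>Here \<open>x\<close> and \<open>y\<close> are relative values at ages
      \<open>p\<close> and \<open>q\<close>, normalised by \<open>x = 0\<close>. The optimal cycle
      fixes \<open>y\<close>: when it is \<open>p\<close> or the alternating one, the action of
      duration \<open>p\<close> is taken at age \<open>q\<close>; when it is \<open>q\<close>, the
      action of duration \<open>q\<close> is taken at age \<open>p\<close>.\<close>
    assume "\<theta> = t1"
    then show ?thesis
      using t le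
      by (intro exI[of _ \<theta>] exI[of _ 0] exI[of _ "p * q + \<alpha> - \<theta> * p"]) (auto simp: algebra_simps)
  next
    assume "\<theta> = t2"
    then show ?thesis
      using t le
      by (intro exI[of _ \<theta>] exI[of _ 0] exI[of _ "\<theta> * q - q * p - \<beta>"]) (auto simp: algebra_simps)
  next
    assume "\<theta> = t3"
    then show ?thesis
      using t le
      by (intro exI[of _ \<theta>] exI[of _ 0] exI[of _ "p * q + \<alpha> - \<theta> * p"]) (auto simp: algebra_simps)
  qed
qed

text \<open>Here \<open>w\<close> is the value of the better transmission, and
  \<open>real s - \<theta>\<close> is the relative cost of one idle minislot. Idling only refers to
  the next age, so the values below \<open>m\<close> follow by descending from \<open>m\<close>,
  without a fixed point.\<close>

function backward :: "nat \<Rightarrow> (nat \<Rightarrow> real) \<Rightarrow> real \<Rightarrow> nat \<Rightarrow> real" where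
  "backward m w \<theta> s =
     (if m \<le> s then w s else min (w s) (real s - \<theta> + backward m w \<theta> (Suc s)))"
  by auto
termination by (relation "Wellfounded.measure (\<lambda>(m, w, \<theta>, s). m - s)") auto

declare backward.simps [simp del]

text \<open>Naming the faster action \<open>a\<close> and the slower \<open>b\<close> serves both
  orderings of the durations. The separate \<open>c\<close> carries the energy bound because in a
  tie the chosen fastest action may be \<open>b\<close>.\<close>

lemma switch_policy_optimal:
  assumes M: "valid_params M" and ab: "{a, b} = {Direct, Preprocess}"
    and le: "duration M a \<le> duration M b"
    and c: "c \<in> {a, b}" "duration M c = duration M a"
    and energy: "weight M * energy M c \<le> real (duration M c) * (real (duration M c) + 1) / 2"
    and D: "2 * duration M a + duration M b \<le> D" and eps: "eps > 0"
  shows "\<exists>\<pi> \<Omega>. optimal_policy M D eps \<pi> \<and> duration M a \<le> \<Omega> \<and>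
    (\<forall>s\<in>{duration M a..D}. (s < \<Omega> \<longrightarrow> \<pi> s = b) \<and> (\<Omega> \<le> s \<longrightarrow> \<pi> s = a))"
proof -
  define m where "m = duration M a"
  define n where "n = duration M b"
  \<comment> \<open>\<open>\<alpha>\<close> and \<open>\<beta>\<close> are the age-independent parts
    of the costs: transmitting at age \<open>s\<close> costs \<open>m * s + \<alpha>\<close> or
    \<open>n * s + \<beta>\<close>.\<close>
  define \<alpha> where "\<alpha> = real m * (real m - 1) / 2 + weight M * energy M a"
  define \<beta> where "\<beta> = real n * (real n - 1) / 2 + weight M * energy M b"
  have mn: "0 < m" "0 < n" "m \<le> n" "2 * m + n \<le> D"
    using duration_pos[OF M] le D by (auto simp: m_def n_def)
  have noidle: "a \<noteq> Idle" "b \<noteq> Idle" and act: "x = Idle \<or> x = a \<or> x = b" for x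
    using ab by (cases x; auto simp: doubleton_eq_iff)+
  obtain \<theta> x y :: real where th: "\<theta> * m \<le> real m * m + \<alpha>" "\<theta> * n \<le> real n * n + \<beta>"
    and x: "x = min (real m * m + \<alpha> - \<theta> * m + x) (real n * m + \<beta> - \<theta> * n + y)"
    and y: "y = min (real m * n + \<alpha> - \<theta> * m + x) (real n * n + \<beta> - \<theta> * n + y)"
    using two_state_bellman[of "real m" "real n" \<alpha> \<beta>] mn by auto
  define u where "u s = real m * real s + \<alpha> - \<theta> * m + x" for s :: nat
  define v where "v s = real n * real s + \<beta> - \<theta> * n + y" for s :: nat
  define w where "w s = min (u s) (v s)" for s
  define h where "h = backward m w \<theta>"
  have h_ge: "h s = w s" if "m \<le> s" for s
    using that by (simp add: h_def backward.simps)
  have h_less: "h s = min (w s) (real s - \<theta> + h (Suc s))" if "s < m" for s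
    using that unfolding h_def by (subst backward.simps) simp
  \<comment> \<open>The equations for \<open>x\<close> and \<open>y\<close> read
    \<open>x = w m\<close> and \<open>y = w n\<close>, so the constants in \<open>u\<close> and
    \<open>v\<close> are indeed the values of \<open>h\<close> at the successors.\<close>
  have hm: "h m = x" and hn: "h n = y"
    using x y mn h_ge[of m] h_ge[of n] by (simp_all add: w_def u_def v_def)
  have theta: "\<theta> \<le> 2 * real m"
  proof -
    \<comment> \<open>The cycle repeating \<open>c\<close> costs
      \<open>m * m + m * (m - 1) / 2\<close> plus weighted energy, which is at most
      \<open>m * (m + 1) / 2\<close>; the sum is at most \<open>2 * m * m\<close>.\<close>
    have "\<theta> * m \<le> 2 * real m * real m"
      using c energy th by (auto simp: \<alpha>_def \<beta>_def m_def n_def field_simps)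
    then show ?thesis using mn by simp
  qed
  have next_a: "next_state M D s a = m" and next_b: "next_state M D s b = n" for s
    using mn noidle by (simp_all add: next_state_def m_def n_def)
  have cost_a: "step_cost M s a - \<theta> * real (duration M a) + h (next_state M D s a) = u s"
    and cost_b: "step_cost M s b - \<theta> * real (duration M b) + h (next_state M D s b) = v s" for s
    unfolding next_a next_b hm hn
    by (simp_all add: step_cost_def u_def v_def \<alpha>_def \<beta>_def flip: m_def n_def) (simp_all add: field_simps)
  have cost_idle: "step_cost M s Idle - \<theta> * real (duration M Idle) + h (next_state M D s Idle) =
      real s - \<theta> + h (min (s + 1) D)" for s
    by (simp add: step_cost_def next_state_def)
  have h_le_w: "h s \<le> w s" for s
    using h_ge[of s] h_less[of s] by (cases "m \<le> s") auto
  have h_le_idle: "h s \<le> real s - \<theta> + h (min (s + 1) D)" if "s \<in> states D" for s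
  proof (cases "m \<le> s")
    case True
    show ?thesis
    proof (cases "s = D")
      case True
      \<comment> \<open>Idling at the cap leaves the age unchanged, so \<open>h\<close> cancels and
        the size of \<open>D\<close> has to suffice.\<close>
      have "\<theta> \<le> real D" using theta mn by linarith
      then show ?thesis using True by simp
    next
      case False
      then have "min (s + 1) D = Suc s" using that by (auto simp: states_def)
      moreover have "w s + real m \<le> w (Suc s)"
        using mn by (auto simp: w_def u_def v_def algebra_simps min_def)
      ultimately show ?thesis using True theta h_ge[of s] h_ge[of "Suc s"] by simp
    qed
  next
    case False
    then show ?thesis using mn h_less[of s] by simp
  qed
  have lower: "h s \<le> step_cost M s d - \<theta> * real (duration M d) + h (next_state M D s d)"
    if "s \<in> states D" for s d
    using act[of d] h_le_w[of s] h_le_idle[OF that] cost_a[of s] cost_b[of s] cost_idle[of s]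
    by (auto simp: w_def)
  text \<open>The disjunct \<open>D < s\<close> covers \<open>m = n\<close>, where \<open>v < u\<close> may hold everywhere.\<close>
  define \<Omega> where "\<Omega> = (LEAST s. m \<le> s \<and> (D < s \<or> u s \<le> v s))"
  have Om: "m \<le> \<Omega> \<and> (D < \<Omega> \<or> u \<Omega> \<le> v \<Omega>)"
    unfolding \<Omega>_def by (rule LeastI[of _ "Suc D"]) (use mn in simp)
  have below: "v s \<le> u s" if "m \<le> s" "s < \<Omega>" for s
    using not_less_Least[of s "\<lambda>s. m \<le> s \<and> (D < s \<or> u s \<le> v s)"] that by (auto simp: \<Omega>_def)
  have above: "u s \<le> v s" if "\<Omega> \<le> s" "s \<le> D" for s
  proof -
    \<comment> \<open>The difference \<open>v - u\<close> has slope \<open>n - m\<close>, hence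
      stays nonnegative from \<open>\<Omega>\<close> on.\<close>
    have "(real n - real m) * real \<Omega> \<le> (real n - real m) * real s"
      using that mn by (intro mult_left_mono) auto
    then show ?thesis using Om that by (auto simp: u_def v_def algebra_simps)
  qed
  \<comment> \<open>Below \<open>m\<close> any minimiser will do; \<open>Idle\<close> attains the
    minimum if neither transmission does.\<close>
  define \<pi> where "\<pi> s = (if m \<le> s then if s < \<Omega> then b else a
    else if h s = u s then a else if h s = v s then b else Idle)" for s
  have attained:
    "h s = step_cost M s (\<pi> s) - \<theta> * real (duration M (\<pi> s)) + h (next_state M D s (\<pi> s))"
    if "s \<in> states D" for s
  proof (cases "m \<le> s")
    case True
    then show ?thesis
      using h_ge[of s] below[of s] above[of s] that cost_a[of s] cost_b[of s]
      by (auto simp: \<pi>_def w_def states_def)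
  next
    case False
    then show ?thesis
      using h_less[of s] cost_a[of s] cost_b[of s] cost_idle[of s] mn
      by (auto simp: \<pi>_def w_def min_def split: if_splits)
  qed
  \<comment> \<open>If \<open>\<Omega> \<le> m\<close>, both \<open>m\<close> and \<open>n\<close>
    use \<open>a\<close> and move to \<open>m\<close>; otherwise \<open>m\<close> uses
    \<open>b\<close> and moves to \<open>n\<close>.\<close>
  define z where "z = (if \<Omega> \<le> m then m else n)"
  have in_states: "m \<in> states D" "n \<in> states D" using mn by (auto simp: states_def)
  have refl: "(s, s) \<in> reach M D \<pi>" for s by (simp add: reach_def)
  have zm: "(m, z) \<in> reach M D \<pi>" and zn: "(n, z) \<in> reach M D \<pi>"
    using reach_step[OF M in_states(1), of \<pi> z] reach_step[OF M in_states(2), of \<pi> z] refl[of z] mn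
    by (auto simp: z_def \<pi>_def next_a next_b)
  have trans: "(s, z) \<in> reach M D \<pi>" if "s \<in> states D" "\<pi> s = a \<or> \<pi> s = b" for s
    using that(2) zm zn next_a[of s] next_b[of s] by (intro reach_step[OF M that(1)]) auto
  have "(s, z) \<in> reach M D \<pi>" if "s \<in> states D" for s
    using that
  \<comment> \<open>The policy idles only below \<open>m\<close>, and each idle step brings the age
    closer to \<open>m\<close>, so a transmission eventually occurs.\<close>
  proof (induction "m - s" arbitrary: s)
    case 0
    then show ?case by (intro trans) (auto simp: \<pi>_def)
  next
    case (Suc k)
    show ?case
    proof (cases "\<pi> s = Idle")
      case True
      have "next_state M D s (\<pi> s) = Suc s" using True Suc.hyps mn by (simp add: next_state_def)
      moreover have "(Suc s, z) \<in> reach M D \<pi>"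
        using Suc.hyps mn by (intro Suc.hyps(1)) (auto simp: states_def)
      ultimately show ?thesis by (intro reach_step[OF M Suc.prems]) simp
    next
      case False
      then show ?thesis using act[of "\<pi> s"] trans[OF Suc.prems] by auto
    qed
  qed
  then have "unichain M D \<pi>" by (rule unichain_if_common_reachable)
  then have "optimal_policy M D eps \<pi>"
    using lower attained by (rule optimal_policy_verification[OF M eps])
  then show ?thesis
    using Om by (intro exI[of _ \<pi>] exI[of _ \<Omega>]) (auto simp: \<pi>_def m_def)
qed

theorem theorem2:
  fixes M :: status_update and af :: action
  assumes "valid_params M"
    and "fastest M af"
    and "real (duration M af) * (real (duration M af) + 1) / 2 \<ge> weight M * energy M af"
  shows "\<exists>N. \<forall>D\<ge>N. \<forall>eps. 0 < eps \<and> eps \<le> real (Min (range (duration M))) \<longrightarrow>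
    (upd_size M \<le> pre_time M + pre_size M \<longrightarrow>
      (\<exists>\<pi> \<Omega>. optimal_policy M D eps \<pi> \<and>
        \<Omega> \<ge> min (upd_size M) (pre_time M + pre_size M) \<and>
        (\<forall>s\<in>main_states M D.
          (upd_size M \<le> s \<and> s < \<Omega> \<longrightarrow> \<pi> s = Preprocess) \<and>
          (s \<ge> \<Omega> \<longrightarrow> \<pi> s = Direct)))) \<and>
    (upd_size M \<ge> pre_time M + pre_size M \<longrightarrow>
      (\<exists>\<pi> \<Omega>. optimal_policy M D eps \<pi> \<and>
        \<Omega> \<ge> min (upd_size M) (pre_time M + pre_size M) \<and>
        (\<forall>s\<in>main_states M D.
          (pre_time M + pre_size M \<le> s \<and> s < \<Omega> \<longrightarrow> \<pi> s = Direct) \<and>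
          (s \<ge> \<Omega> \<longrightarrow> \<pi> s = Preprocess))))"
proof (intro exI[of _ "2 * (duration M Direct + duration M Preprocess)"] allI impI conjI)
  \<comment> \<open>The chosen bound dominates twice the shorter duration plus the longer one in
    either ordering.\<close>
  fix D :: nat and eps :: real
  assume D: "2 * (duration M Direct + duration M Preprocess) \<le> D"
    and eps: "0 < eps \<and> eps \<le> real (Min (range (duration M)))"
  show "\<exists>\<pi> \<Omega>. optimal_policy M D eps \<pi> \<and>
      \<Omega> \<ge> min (upd_size M) (pre_time M + pre_size M) \<and>
      (\<forall>s\<in>main_states M D.
        (upd_size M \<le> s \<and> s < \<Omega> \<longrightarrow> \<pi> s = Preprocess) \<and>
        (s \<ge> \<Omega> \<longrightarrow> \<pi> s = Direct))"
    if le: "upd_size M \<le> pre_time M + pre_size M"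
  proof -
    have "af \<in> {Direct, Preprocess}" "duration M af = duration M Direct"
      using assms(2) le by (auto simp: fastest_def)
    from switch_policy_optimal[OF assms(1) refl _ this assms(3), of D eps] show ?thesis
      using D eps le by (auto simp: main_states_def min_absorb1)
  qed
  show "\<exists>\<pi> \<Omega>. optimal_policy M D eps \<pi> \<and>
      \<Omega> \<ge> min (upd_size M) (pre_time M + pre_size M) \<and>
      (\<forall>s\<in>main_states M D.
        (pre_time M + pre_size M \<le> s \<and> s < \<Omega> \<longrightarrow> \<pi> s = Direct) \<and>
        (s \<ge> \<Omega> \<longrightarrow> \<pi> s = Preprocess))"
    if le: "upd_size M \<ge> pre_time M + pre_size M"
  proof -
    have "af \<in> {Preprocess, Direct}" "duration M af = duration M Preprocess"
      using assms(2) le by (auto simp: fastest_def)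
    from switch_policy_optimal[OF assms(1) insert_commute _ this assms(3), of D eps] show ?thesis
      using D eps le by (auto simp: main_states_def min_absorb2)
  qed
qed

end
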